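(* Consider the Gaussian MIMO $K$-receiver wiretap channel with fixed channels $\mathbf{H}_1,\dots,\mathbf{H}_K,\mathbf{G}$, total power $P>0$, and fixed nonnegative weights $w_1,\dots,w_K$ summing to one. For each permutation $\pi$ of $\{1,\dots,K\}$ let $$\varphi_\pi(P)=\max_{\mathbf{Q}_{1},\dots,\mathbf{Q}_{K}\succcurlyeq\mathbf{0},\ \sum_k\mathrm{tr}(\mathbf{Q}_k)\le P}\ \sum_{k=1}^K w_{\pi_k}R_{\pi_k}$$ be the maximal weighted secrecy sum-rate achievable with encoding order $\pi$. Then a permutation $\pi^*$ whose weights are ordered so that $w_{\pi^*_1}\ge w_{\pi^*_2}\ge\cdots\ge w_{\pi^*_K}$ (equivalently, the corresponding decoding order, which is the reverse of $\pi^*$, has nondecreasing weights) satisfies $\varphi_{\pi^*}(P)=\max_{\pi}\varphi_{\pi}(P)$. In other words, a receiver with a larger weight should be encoded earlier, exactly as in the MIMO broadcast channel without secrecy, and a single encoding order (determined by the weights) suffices to attain the maximum weighted secrecy sum-rate, hence each boundary point of the secrecy capacity region supporting the weight vector $(w_1,\dots,w_K)$, without enumerating all $K!$ orders.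
   Context: Gaussian MIMO $K$-receiver wiretap channel: transmitter with $n_t$ antennas, receiver $k$ observes $\mathbf{y}_k=\mathbf{H}_k\mathbf{x}+\mathbf{w}_k$ ($\mathbf{H}_k\in\mathbb{C}^{n_k\times n_t}$), eavesdropper observes $\mathbf{y}_e=\mathbf{G}\mathbf{x}+\mathbf{w}_e$ ($\mathbf{G}\in\mathbb{C}^{n_e\times n_t}$), noises circularly symmetric complex Gaussian with identity covariance; input $\mathbf{x}=\sum_k\mathbf{x}_k$, $\mathbf{x}_k\sim\mathcal{CN}(0,\mathbf{Q}_k)$ independent, $\mathbf{Q}_k\succcurlyeq\mathbf{0}$. With (secret) dirty-paper encoding order $\pi=[\pi_1,\dots,\pi_K]$ (receiver $\pi_1$ encoded first), the secrecy rate of receiver $\pi_k$ is $$R_{\pi_k}=\log\frac{\big|\mathbf{I}+\mathbf{H}_{\pi_k}\big(\sum_{j=k}^K\mathbf{Q}_{\pi_j}\big)\mathbf{H}_{\pi_k}^\dagger\big|}{\big|\mathbf{I}+\mathbf{H}_{\pi_k}\big(\sum_{j=k+1}^K\mathbf{Q}_{\pi_j}\big)\mathbf{H}_{\pi_k}^\dagger\big|}-\log\frac{\big|\mathbf{I}+\mathbf{G}\big(\sum_{j=k}^K\mathbf{Q}_{\pi_j}\big)\mathbf{G}^\dagger\big|}{\big|\mathbf{I}+\mathbf{G}\big(\sum_{j=k+1}^K\mathbf{Q}_{\pi_j}\big)\mathbf{G}^\dagger\big|},$$ empty sums being $\mathbf{0}$, logarithms natural, $^\dagger$ conjugate transpose,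 $|\cdot|$ determinant. The secrecy capacity region under total power $P$ is the convex closure of the union over all permutations $\pi$ of the achievable rate sets of this form with $\sum_k\mathrm{tr}(\mathbf{Q}_k)\le P$. *)

theory Defs
  imports "Jordan_Normal_Form.Matrix" "Jordan_Normal_Form.Determinant"
    "HOL-Combinatorics.Permutations"
begin

definition ctrans :: "complex mat \<Rightarrow> complex mat" where
  "ctrans A = mat (dim_col A) (dim_row A) (\<lambda>(i,j). cnj (A $$ (j,i)))"

definition mtrace :: "complex mat \<Rightarrow> complex" where
  "mtrace A = (\<Sum>i<dim_row A. A $$ (i,i))"

definition psd :: "nat \<Rightarrow> complex mat \<Rightarrow> bool" where
  "psd n Q \<longleftrightarrow> Q \<in> carrier_mat n n \<and> ctrans Q = Q \<and>
     (\<forall>v :: nat \<Rightarrow> complex. 0 \<le> Re (\<Sum>i<n. \<Sum>j<n. cnj (v i) * Q $$ (i,j) * v j))"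

text \<open>Sum of the covariances of the receivers encoded at positions k, ..., K-1
  (positions are 0-based; ord m is the receiver at position m); empty sum = 0.\<close>
definition tail_cov :: "nat \<Rightarrow> nat \<Rightarrow> (nat \<Rightarrow> nat) \<Rightarrow> (nat \<Rightarrow> complex mat) \<Rightarrow> nat \<Rightarrow> complex mat" where
  "tail_cov nt K ord Q k = mat nt nt (\<lambda>(i,j). \<Sum>m\<in>{k..<K}. Q (ord m) $$ (i,j))"

text \<open>log |I + A S A^\<dagger>| (natural logarithm; the determinant is real positive for PSD S).\<close>
definition logdet_gain :: "complex mat \<Rightarrow> complex mat \<Rightarrow> real" where
  "logdet_gain A S = ln (Re (det (1\<^sub>m (dim_row A) + A * S * ctrans A)))"

definition secrecy_rate ::
  "nat \<Rightarrow> nat \<Rightarrow> (nat \<Rightarrow> complex mat) \<Rightarrow> complex mat \<Rightarrow> (nat \<Rightarrow> nat) \<Rightarrow> (nat \<Rightarrow> complex mat) \<Rightarrow> nat \<Rightarrow> real" where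
  "secrecy_rate nt K H G ord Q k =
     (logdet_gain (H (ord k)) (tail_cov nt K ord Q k) - logdet_gain (H (ord k)) (tail_cov nt K ord Q (Suc k)))
   - (logdet_gain G (tail_cov nt K ord Q k) - logdet_gain G (tail_cov nt K ord Q (Suc k)))"

definition feasible_cov :: "nat \<Rightarrow> nat \<Rightarrow> real \<Rightarrow> (nat \<Rightarrow> complex mat) \<Rightarrow> bool" where
  "feasible_cov nt K P Q \<longleftrightarrow> (\<forall>k<K. psd nt (Q k)) \<and> (\<Sum>k<K. Re (mtrace (Q k))) \<le> P"

definition phi ::
  "nat \<Rightarrow> nat \<Rightarrow> (nat \<Rightarrow> complex mat) \<Rightarrow> complex mat \<Rightarrow> (nat \<Rightarrow> real) \<Rightarrow> real \<Rightarrow> (nat \<Rightarrow> nat) \<Rightarrow> real" where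
  "phi nt K H G w P ord =
     Sup {(\<Sum>k<K. w (ord k) * secrecy_rate nt K H G ord Q k) | Q. feasible_cov nt K P Q}"

end

theory Submission
  imports Defs "Jordan_Normal_Form.Char_Poly"
begin

text \<open>
  It suffices to exchange two neighbours \<open>b, a\<close> in the encoding order with \<open>w b \<le> w a\<close>, keeping all
  tail covariances except the one between them. Let \<open>B \<le> B + X \<le> B + X + Z\<close> be the three tail
  covariances involved, and write \<open>gain M S = ln |1 + M S|\<close> with the Gram matrices \<open>M = H\<^sup>\<dagger> H\<close>; after
  replacing every \<open>M\<close> by \<open>(1 + M B)\<inverse> M\<close> we may take \<open>B = 0\<close>. The new intermediate covariance \<open>W\<close> is
  obtained by reflecting \<open>X\<close> between \<open>0\<close> and \<open>X + Z\<close> in the coordinate \<open>S \<mapsto> S (1 + M\<^sub>a S)\<inverse>\<close>. With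
  \<open>\<Delta>\<^sub>N = gain N (X + Z) - gain N X - gain N W\<close> the weighted rate increases by
  \<open>w b (\<Delta>\<^sub>a - \<Delta>\<^sub>b) + (w a - w b) (\<Delta>\<^sub>a - \<Delta>\<^sub>G)\<close>, which is nonnegative because \<open>\<Delta>\<^sub>N \<le> \<Delta>\<^sub>a\<close> for every
  positive semidefinite \<open>N\<close>. The latter reduces, after cancelling determinants, to the identity
  \<open>M X M + N = (1 + M X) N\<^sub>X (1 + X M) + (M - N) X (1 + N X)\<inverse> (M - N)\<close> with
  \<open>N\<^sub>X = (1 + N X)\<inverse> N\<close>, whose last summand is positive semidefinite.
\<close>

subsection \<open>Positive semidefinite matrices\<close>

lemma ctrans_carrier [simp]: "A \<in> carrier_mat n m \<Longrightarrow> ctrans A \<in> carrier_mat m n"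
  by (auto simp: ctrans_def)

lemma ctrans_dim [simp]: "dim_row (ctrans A) = dim_col A" "dim_col (ctrans A) = dim_row A"
  by (auto simp: ctrans_def)

lemma ctrans_ctrans [simp]: "ctrans (ctrans A) = A"
  by (rule eq_matI) (auto simp: ctrans_def)

lemma ctrans_one [simp]: "ctrans (1\<^sub>m n) = 1\<^sub>m n"
  by (rule eq_matI) (auto simp: ctrans_def)

lemma ctrans_add:
  "A \<in> carrier_mat n m \<Longrightarrow> B \<in> carrier_mat n m \<Longrightarrow> ctrans (A + B) = ctrans A + ctrans B"
  by (rule eq_matI) (auto simp: ctrans_def)

lemma ctrans_minus:
  "A \<in> carrier_mat n m \<Longrightarrow> B \<in> carrier_mat n m \<Longrightarrow> ctrans (A - B) = ctrans A - ctrans B"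
  by (rule eq_matI) (auto simp: ctrans_def)

lemma ctrans_mult:
  "A \<in> carrier_mat n m \<Longrightarrow> B \<in> carrier_mat m k \<Longrightarrow> ctrans (A * B) = ctrans B * ctrans A"
  by (rule eq_matI) (auto simp: ctrans_def scalar_prod_def mult.commute intro!: sum.cong)

lemma cscalar_prod_mult_mat_vec:
  assumes "A \<in> carrier_mat n m" "y \<in> carrier_vec m" "x \<in> carrier_vec n"
  shows "conjugate x \<bullet> (A *\<^sub>v y) = (\<Sum>i<n. \<Sum>j<m. cnj (x $ i) * A $$ (i,j) * y $ j)"
  using assms by (auto simp: scalar_prod_def sum_distrib_left lessThan_atLeast0 mult.assoc intro!: sum.cong)

lemma cscalar_prod_ctrans:
  assumes "A \<in> carrier_mat n m" "y \<in> carrier_vec m" "x \<in> carrier_vec n"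
  shows "conjugate x \<bullet> (A *\<^sub>v y) = conjugate (ctrans A *\<^sub>v x) \<bullet> y"
proof -
  have "conjugate (ctrans A *\<^sub>v x) \<bullet> y = (\<Sum>j<m. \<Sum>i<n. cnj (x $ i) * A $$ (i,j) * y $ j)"
    using assms by (auto simp: scalar_prod_def sum_distrib_right lessThan_atLeast0 ctrans_def
        mult.commute[of _ "cnj _"] intro!: sum.cong)
  then show ?thesis
    unfolding cscalar_prod_mult_mat_vec[OF assms] by (subst sum.swap) simp
qed

lemma cscalar_prod_swap:
  fixes x :: "complex vec"
  assumes "x \<in> carrier_vec n" "y \<in> carrier_vec n"
  shows "conjugate x \<bullet> y = cnj (conjugate y \<bullet> x)"
  using assms by (auto simp: scalar_prod_def mult.commute intro!: sum.cong)

text \<open>Replaces functions on indices by vectors of dimension \<open>n\<close>, so that the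
  matrix-vector algebra applies to the quadratic form.\<close>

lemma psd_vec_iff:
  "psd n Q \<longleftrightarrow> Q \<in> carrier_mat n n \<and> ctrans Q = Q \<and>
     (\<forall>v \<in> carrier_vec n. 0 \<le> Re (conjugate v \<bullet> (Q *\<^sub>v v)))"
proof -
  have "(\<forall>v \<in> carrier_vec n. 0 \<le> Re (conjugate v \<bullet> (Q *\<^sub>v v))) \<longleftrightarrow>
    (\<forall>v :: nat \<Rightarrow> complex. 0 \<le> Re (\<Sum>i<n. \<Sum>j<n. cnj (v i) * Q $$ (i,j) * v j))"
    (is "?L \<longleftrightarrow> ?R") if Q: "Q \<in> carrier_mat n n"
  proof
    assume L: ?L
    show ?R
    proof
      fix v :: "nat \<Rightarrow> complex"
      from L have "0 \<le> Re (conjugate (vec n v) \<bullet> (Q *\<^sub>v vec n v))" by simp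
      then show "0 \<le> Re (\<Sum>i<n. \<Sum>j<n. cnj (v i) * Q $$ (i,j) * v j)"
        by (subst (asm) cscalar_prod_mult_mat_vec[OF Q]) auto
    qed
  next
    assume ?R
    then show ?L using cscalar_prod_mult_mat_vec[OF Q] by auto
  qed
  then show ?thesis unfolding psd_def by blast
qed

lemma psd_carrier: "psd n Q \<Longrightarrow> Q \<in> carrier_mat n n"
  and psd_ctrans: "psd n Q \<Longrightarrow> ctrans Q = Q"
  by (simp_all add: psd_def)

lemma psd_add:
  assumes "psd n P" "psd n Q"
  shows "psd n (P + Q)"
proof -
  note c = assms[THEN psd_carrier]
  show ?thesis unfolding psd_vec_iff
    using assms c
    by (auto simp: psd_vec_iff ctrans_add[of _ n n] add_mult_distrib_mat_vec[of _ n n]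
        scalar_prod_add_distrib[of _ n])
qed

lemma psd_congruence:
  assumes P: "psd n P" and A: "A \<in> carrier_mat n m"
  shows "psd m (ctrans A * P * A)"
proof -
  note c = psd_carrier[OF P]
  have "ctrans (ctrans A * P * A) = ctrans A * P * A"
    using A c psd_ctrans[OF P]
    by (simp add: ctrans_mult[of _ m n _ m] ctrans_mult[of _ m n _ n] ctrans_mult[of _ n n _ m] assoc_mult_mat[of _ m n _ n _ m])
  moreover have "0 \<le> Re (conjugate v \<bullet> (ctrans A * P * A *\<^sub>v v))" if v: "v \<in> carrier_vec m" for v
  proof -
    have "ctrans A * P * A *\<^sub>v v = ctrans A *\<^sub>v (P *\<^sub>v (A *\<^sub>v v))"
      using A c v mult_carrier_mat[OF ctrans_carrier[OF A] c]
      by (simp add: assoc_mult_mat_vec[of _ m n _ m] assoc_mult_mat_vec[of _ m n _ n])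
    then have "conjugate v \<bullet> (ctrans A * P * A *\<^sub>v v) = conjugate (A *\<^sub>v v) \<bullet> (P *\<^sub>v (A *\<^sub>v v))"
      using A c v by (simp add: cscalar_prod_ctrans[of _ m n])
    then show ?thesis using P A v by (auto simp: psd_vec_iff)
  qed
  ultimately show ?thesis using A c by (auto simp: psd_vec_iff)
qed

lemma psd_one: "psd n (1\<^sub>m n)"
  by (auto simp: psd_vec_iff scalar_prod_def intro!: sum_nonneg)

lemma psd_zero: "psd n (0\<^sub>m n n)"
  by (auto simp: psd_def ctrans_def)

lemma psd_gram:
  assumes "A \<in> carrier_mat n m"
  shows "psd m (ctrans A * A)"
  using psd_congruence[OF psd_one assms] assms by simp

lemma psd_form_real:
  assumes "psd n Q" "v \<in> carrier_vec n"
  shows "Im (conjugate v \<bullet> (Q *\<^sub>v v)) = 0"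
proof -
  have "conjugate v \<bullet> (Q *\<^sub>v v) = conjugate (Q *\<^sub>v v) \<bullet> v"
    using cscalar_prod_ctrans[of Q n n v v] assms by (auto simp: psd_def)
  also have "\<dots> = cnj (conjugate v \<bullet> (Q *\<^sub>v v))"
    using psd_carrier[OF assms(1)] assms(2) by (intro cscalar_prod_swap[of _ n]) auto
  finally show ?thesis by (simp add: complex_eq_iff)
qed

text \<open>Perturb \<open>v\<close> in the direction \<open>u = Q v\<close>. The form at
  \<open>v + t u\<close> is the real quadratic \<open>2 t b + t^2 a\<close> with
  \<open>b = |u|^2\<close> and no constant term; it can stay nonnegative for small negative
  \<open>t\<close> only if \<open>b = 0\<close>.\<close>

lemma psd_form_eq_0:
  assumes Q: "psd n Q" and v: "v \<in> carrier_vec n"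
    and 0: "Re (conjugate v \<bullet> (Q *\<^sub>v v)) = 0"
  shows "Q *\<^sub>v v = 0\<^sub>v n"
proof -
  note c = psd_carrier[OF Q]
  define u where "u = Q *\<^sub>v v"
  have u: "u \<in> carrier_vec n" using c v by (simp add: u_def)
  define a where "a = Re (conjugate u \<bullet> (Q *\<^sub>v u))"
  define b where "b = Re (conjugate u \<bullet> u)"
  have Qu: "conjugate v \<bullet> (Q *\<^sub>v u) = conjugate u \<bullet> u"
    using cscalar_prod_ctrans[OF c u v] psd_ctrans[OF Q] by (simp add: u_def)
  have pos: "0 \<le> 2 * t * b + t\<^sup>2 * a" for t :: real
  proof -
    let ?t = "complex_of_real t"
    have "Q *\<^sub>v (v + ?t \<cdot>\<^sub>v u) = u + ?t \<cdot>\<^sub>v (Q *\<^sub>v u)"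
      using c u v by (simp add: mult_add_distrib_mat_vec[of _ n n] mult_mat_vec[of _ n n] u_def)
    moreover have "conjugate (v + ?t \<cdot>\<^sub>v u) = conjugate v + ?t \<cdot>\<^sub>v conjugate u"
      using u v by (intro eq_vecI) (auto simp: conjugate_vec_def)
    ultimately have "conjugate (v + ?t \<cdot>\<^sub>v u) \<bullet> (Q *\<^sub>v (v + ?t \<cdot>\<^sub>v u)) =
       conjugate v \<bullet> u + ?t * (conjugate u \<bullet> u) + ?t * (conjugate u \<bullet> u + ?t * (conjugate u \<bullet> (Q *\<^sub>v u)))"
      using u v c Qu
      by (simp add: add_scalar_prod_distrib[of _ n] scalar_prod_add_distrib[of _ n])
    moreover have "0 \<le> Re (conjugate (v + ?t \<cdot>\<^sub>v u) \<bullet> (Q *\<^sub>v (v + ?t \<cdot>\<^sub>v u)))"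
      using Q u v by (auto simp: psd_vec_iff)
    ultimately show ?thesis
      using 0 by (simp add: a_def b_def u_def[symmetric] algebra_simps power2_eq_square)
  qed
  have "0 \<le> a" using Q u by (auto simp: a_def psd_vec_iff)
  have "b \<le> 0"
  proof (rule ccontr)
    assume "\<not> b \<le> 0"
    \<comment> \<open>The minimiser would be \<open>- b / a\<close>; the added 1 keeps the
      denominator positive when \<open>a = 0\<close>.\<close>
    with pos[of "- b / (a + 1)"] \<open>0 \<le> a\<close> have "0 \<le> (- b\<^sup>2) * (a + 2) / (a + 1)\<^sup>2"
      by (simp add: power2_eq_square divide_simps split: if_splits)
    moreover have "(- b\<^sup>2) * (a + 2) / (a + 1)\<^sup>2 < 0"
      using \<open>\<not> b \<le> 0\<close> \<open>0 \<le> a\<close> by (intro divide_neg_pos mult_neg_pos) auto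
    ultimately show False by simp
  qed
  moreover have "b = (\<Sum>i<n. (cmod (u $ i))\<^sup>2)"
    using u by (auto simp: b_def scalar_prod_def lessThan_atLeast0 cmod_power2[unfolded power2_eq_square] power2_eq_square
        intro!: sum.cong)
  ultimately have "(\<Sum>i<n. (cmod (u $ i))\<^sup>2) = 0"
    by (metis antisym sum_nonneg zero_le_power2)
  then have "\<forall>i<n. u $ i = 0"
    by (subst (asm) sum_nonneg_eq_0_iff) auto
  then show ?thesis using u by (auto simp: u_def[symmetric])
qed

section \<open>Spectrum and determinants of products of psd matrices\<close>

lemma eigenvalue_psd_mult:
  assumes P: "psd n P" and Q: "psd n Q" and ev: "eigenvalue (P * Q) \<mu>"
  shows "Im \<mu> = 0 \<and> 0 \<le> Re \<mu>"
proof -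
  note cP = psd_carrier[OF P] and cQ = psd_carrier[OF Q]
  obtain v where v: "v \<in> carrier_vec n" "v \<noteq> 0\<^sub>v n" and PQ: "P * Q *\<^sub>v v = \<mu> \<cdot>\<^sub>v v"
    using ev cP by (auto simp: eigenvalue_def eigenvector_def)
  \<comment> \<open>\<open>P * Q\<close> is not Hermitian in general. Pairing the eigenvalue
    equation with \<open>u\<close> turns it into \<open><u, P u> = \<mu> <v, Q v>\<close> with both
    forms real and nonnegative. This determines the sign of \<open>\<mu>\<close> unless
    \<open><v, Q v> = 0\<close>, and then \<open>Q v = 0\<close> forces
    \<open>\<mu> = 0\<close>.\<close>
  define u where "u = Q *\<^sub>v v"
  have u: "u \<in> carrier_vec n" using cQ v by (simp add: u_def)
  have Pu: "P *\<^sub>v u = \<mu> \<cdot>\<^sub>v v"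
    using PQ cP cQ v by (simp add: u_def assoc_mult_mat_vec[of _ n n _ n])
  define q where "q = conjugate v \<bullet> (Q *\<^sub>v v)"
  have q: "Im q = 0" "0 \<le> Re q"
    using psd_form_real[OF Q v(1)] Q v by (auto simp: q_def psd_vec_iff)
  have "conjugate u \<bullet> v = q"
    using cscalar_prod_ctrans[OF cQ v(1) v(1)] psd_ctrans[OF Q] by (simp add: u_def q_def)
  then have "conjugate u \<bullet> (P *\<^sub>v u) = \<mu> * q"
    using Pu u v by simp
  then have *: "Im (\<mu> * q) = 0" "0 \<le> Re (\<mu> * q)"
    using psd_form_real[OF P u] P u by (auto simp: psd_vec_iff)
  show ?thesis
  proof (cases "Re q = 0")
    case True
    then have "u = 0\<^sub>v n"
      using psd_form_eq_0[OF Q v(1)] by (simp add: q_def u_def)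
    moreover have "P *\<^sub>v 0\<^sub>v n = 0\<^sub>v n" using cP by (intro eq_vecI) auto
    ultimately have "\<mu> \<cdot>\<^sub>v v = 0\<^sub>v n" using Pu[symmetric] cP by simp
    then have "\<mu> * v $ i = 0" if "i < n" for i
      using that v by (metis carrier_vecD index_smult_vec(1) index_zero_vec(1))
    moreover obtain i where "i < n" "v $ i \<noteq> 0" using v by (metis eq_vecI carrier_vecD index_zero_vec)
    ultimately have "\<mu> = 0" by auto
    then show ?thesis by simp
  next
    case False
    with * q show ?thesis by (auto simp: zero_le_mult_iff)
  qed
qed

text \<open>The determinant is the product of \<open>1 + a\<close> over the eigenvalues
  \<open>a\<close> of \<open>P * Q\<close>, all real and nonnegative. It makes every logarithm below
  one of a real number that is at least 1.\<close>

lemma det_one_plus_psd_mult: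
  assumes P: "psd n P" and Q: "psd n Q"
  shows "det (1\<^sub>m n + P * Q) \<in> \<real>" "1 \<le> Re (det (1\<^sub>m n + P * Q))"
proof -
  note cP = psd_carrier[OF P] and cQ = psd_carrier[OF Q]
  have c: "- P * Q \<in> carrier_mat n n" using cP cQ by auto
  obtain es where es: "char_poly (P * Q) = (\<Prod>a\<leftarrow>es. [:- a, 1:])" and len: "length es = n"
    using char_poly_factorized[of "P * Q" n] cP cQ by auto
  have ev: "Im a = 0 \<and> 0 \<le> Re a" if "a \<in> set es" for a
  proof -
    have "poly (char_poly (P * Q)) a = 0"
      unfolding es using that by (auto simp: poly_prod_list prod_list_zero_iff)
    then show ?thesis
      using eigenvalue_root_char_poly[of "P * Q" n a] eigenvalue_psd_mult[OF P Q] cP cQ by auto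
  qed
  \<comment> \<open>The determinant is read off from the characteristic polynomial at -1; the factor
    \<open>(- 1) ^ n\<close> appears on both sides and cancels.\<close>
  have "- char_matrix (P * Q) (- 1) = (- 1) \<cdot>\<^sub>m (1\<^sub>m n + P * Q)"
    using cP cQ by (intro eq_matI) (auto simp: char_matrix_def)
  then have "(- 1) ^ n * det (1\<^sub>m n + P * Q) = poly (char_poly (P * Q)) (- 1)"
    using char_poly_matrix[of "P * Q" n "-1"] cP cQ by (simp add: det_smult)
  also have "\<dots> = (\<Prod>a\<leftarrow>es. - 1 - a)"
    unfolding es by (induction es) (auto simp: algebra_simps)
  also have "\<dots> = (- 1) ^ n * (\<Prod>a\<leftarrow>es. 1 + a)"
    unfolding len[symmetric]
  proof (induction es)
    case (Cons a es)
    have "(- 1 - a) * (k * p) = (- 1 * k) * ((1 + a) * p)" for k p :: complex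
      by (simp add: algebra_simps)
    then show ?case
      by (simp only: list.map prod_list.Cons length_Cons power_Suc Cons.IH)
  qed simp
  finally have "det (1\<^sub>m n + P * Q) = (\<Prod>a\<leftarrow>es. 1 + a)"
    unfolding mult_cancel_left by simp
  moreover have "(\<Prod>a\<leftarrow>es. 1 + a) \<in> \<real> \<and> 1 \<le> Re (\<Prod>a\<leftarrow>es. 1 + a)"
    using ev
  proof (induction es)
    case (Cons a es)
    then have "a \<in> \<real>" by (simp add: complex_is_Real_iff)
    moreover have "1 * 1 \<le> (1 + Re a) * Re (\<Prod>a\<leftarrow>es. 1 + a)"
      using Cons by (intro mult_mono) auto
    ultimately show ?case using Cons by (auto simp: complex_is_Real_iff)
  qed auto
  ultimately show "det (1\<^sub>m n + P * Q) \<in> \<real>" "1 \<le> Re (det (1\<^sub>m n + P * Q))"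
    by auto
qed

text \<open>Sylvester's determinant identity. Both products \<open>?L * ?F\<close> and
  \<open>?F * ?L\<close> are block upper triangular and have the same determinant; their diagonal
  blocks give the two sides.\<close>

lemma det_one_plus_mult_commute:
  fixes A :: "'a :: idom mat"
  assumes A: "A \<in> carrier_mat n m" and B: "B \<in> carrier_mat m n"
  shows "det (1\<^sub>m n + A * B) = det (1\<^sub>m m + B * A)"
proof -
  let ?F = "four_block_mat (1\<^sub>m n) (- A) B (1\<^sub>m m)"
  let ?L = "four_block_mat (1\<^sub>m n) (0\<^sub>m n m) (- B) (1\<^sub>m m)"
  have F: "?F \<in> carrier_mat (n + m) (n + m)" "?L \<in> carrier_mat (n + m) (n + m)"
    using A B by auto
  have "?L * ?F = four_block_mat (1\<^sub>m n) (- A) (0\<^sub>m m n) (1\<^sub>m m + B * A)"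
    using A B by (subst mult_four_block_mat[of _ n n _ m _ m _ _ n _ m])
       (auto intro!: cong_four_block_mat simp: comm_add_mat[of _ m m])
  moreover have "?F * ?L = four_block_mat (1\<^sub>m n + A * B) (- A) (0\<^sub>m m n) (1\<^sub>m m)"
    using A B by (subst mult_four_block_mat[of _ n n _ m _ m _ _ n _ m])
       (auto intro!: cong_four_block_mat)
  moreover have "det (?L * ?F) = det (?F * ?L)"
    using F by (simp add: det_mult[of _ "n + m"] mult.commute)
  ultimately show ?thesis
    using A B by (simp add: det_four_block_mat_lower_left_zero[of _ n _ m])
qed

subsection \<open>Log-determinants and the reflection\<close>

definition gain :: "complex mat \<Rightarrow> complex mat \<Rightarrow> real" where
  "gain M S = ln (Re (det (1\<^sub>m (dim_row M) + M * S)))"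

context
  fixes n :: nat
begin

text \<open>A normal form for noncommutative algebra: products nested to the right and distributed
  over sums. The dimensions are fixed so that \<open>simp\<close> can discharge the carrier
  premises; together with \<open>add_ac\<close> this settles the matrix identities below.\<close>

private lemmas ring =
  assoc_mult_mat[of _ n n _ n _ n] add_mult_distrib_mat[of _ n n _ _ n] mult_add_distrib_mat[of _ n n _ n]

private lemma left_commute_add:
  "A \<in> carrier_mat n n \<Longrightarrow> B \<in> carrier_mat n n \<Longrightarrow> C \<in> carrier_mat n n \<Longrightarrow>
    A + (B + C) = B + (A + C :: complex mat)"
  by (rule eq_matI) auto

private lemma unit [simp]:
  "A \<in> carrier_mat n n \<Longrightarrow> 1\<^sub>m n * A = (A :: complex mat)"
  "A \<in> carrier_mat n n \<Longrightarrow> A * 1\<^sub>m n = (A :: complex mat)"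
  by simp_all

private lemmas add_ac =
  assoc_add_mat[of _ n n] comm_add_mat[of _ n n] left_commute_add

private lemma add_diff:
  "A \<in> carrier_mat n n \<Longrightarrow> B \<in> carrier_mat n n \<Longrightarrow> A + B - A = (B :: complex mat)"
  by (rule eq_matI) auto

private lemma mult_closed [simp]:
  "A \<in> carrier_mat n n \<Longrightarrow> B \<in> carrier_mat n n \<Longrightarrow> A * B \<in> carrier_mat n n"
  by simp

section \<open>Resolvents of psd products and monotonicity of determinants\<close>

lemma resolvent_exists:
  assumes P: "psd n P" and Q: "psd n Q"
  obtains R where "R \<in> carrier_mat n n" "(1\<^sub>m n + P * Q) * R = 1\<^sub>m n" "R * (1\<^sub>m n + P * Q) = 1\<^sub>m n"
    "ctrans R * (1\<^sub>m n + Q * P) = 1\<^sub>m n" "(1\<^sub>m n + Q * P) * ctrans R = 1\<^sub>m n"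
proof -
  note c [simp] = P[THEN psd_carrier] Q[THEN psd_carrier]
  have "1\<^sub>m n + P * Q \<in> carrier_mat n n" by simp
  moreover have "det (1\<^sub>m n + P * Q) \<noteq> 0"
    using det_one_plus_psd_mult(2)[OF P Q] by force
  ultimately obtain R where R [simp]: "R \<in> carrier_mat n n"
    and *: "(1\<^sub>m n + P * Q) * R = 1\<^sub>m n" "R * (1\<^sub>m n + P * Q) = 1\<^sub>m n"
    using det_non_zero_imp_unit[of "1\<^sub>m n + P * Q" n "()"]
    by (auto simp: Units_def ring_mat_def)
  have "ctrans (1\<^sub>m n + P * Q) = 1\<^sub>m n + Q * P"
    using psd_ctrans[OF P] psd_ctrans[OF Q]
    by (simp add: ctrans_add[of _ n n] ctrans_mult[of _ n n _ n])
  then have "ctrans R * (1\<^sub>m n + Q * P) = 1\<^sub>m n" "(1\<^sub>m n + Q * P) * ctrans R = 1\<^sub>m n"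
    using *[THEN arg_cong[where f = ctrans]] by (simp_all add: ctrans_mult[of _ n n _ n])
  with * R show thesis by (intro that)
qed

text \<open>Inserting \<open>ctrans R * (1 + X * N) = 1\<close> on the left gives
  \<open>X * R = ctrans R * (X + X * N * X) * R\<close>, a congruence of a psd matrix.\<close>

lemma psd_mult_resolvent:
  assumes X: "psd n X" and N: "psd n N"
    and R: "R \<in> carrier_mat n n" "(1\<^sub>m n + N * X) * R = 1\<^sub>m n"
  shows "psd n (X * R)"
proof -
  note c [simp] = X[THEN psd_carrier] N[THEN psd_carrier] R(1)
  have "ctrans ((1\<^sub>m n + N * X) * R) = ctrans R * (1\<^sub>m n + X * N)"
    using psd_ctrans[OF X] psd_ctrans[OF N]
    by (simp add: ctrans_add[of _ n n] ctrans_mult[of _ n n _ n])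
  then have *: "ctrans R * (1\<^sub>m n + X * N) = 1\<^sub>m n" using R by simp
  have "X * R = (ctrans R * (1\<^sub>m n + X * N)) * (X * R)"
    unfolding * by simp
  also have "\<dots> = ctrans R * (X + ctrans X * N * X) * R"
    using psd_ctrans[OF X] by (simp add: ring)
  finally show ?thesis
    using psd_congruence[OF psd_add[OF X psd_congruence[OF N c(1)]] c(3)] by simp
qed

text \<open>The previous lemma with \<open>X\<close> and \<open>N\<close> exchanged shows that
  \<open>N * ctrans R\<close> is psd. Being Hermitian, it equals its own adjoint
  \<open>R * N\<close>.\<close>

lemma psd_resolvent_mult:
  assumes X: "psd n X" and N: "psd n N"
    and R: "R \<in> carrier_mat n n" "R * (1\<^sub>m n + N * X) = 1\<^sub>m n"
  shows "psd n (R * N)"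
proof -
  note c [simp] = X[THEN psd_carrier] N[THEN psd_carrier] R(1)
  have "(1\<^sub>m n + X * N) * ctrans R = ctrans (R * (1\<^sub>m n + N * X))"
    using psd_ctrans[OF X] psd_ctrans[OF N]
    by (simp add: ctrans_add[of _ n n] ctrans_mult[of _ n n _ n])
  then have "psd n (N * ctrans R)" using R by (intro psd_mult_resolvent[OF N X]) auto
  then have "ctrans (N * ctrans R) = N * ctrans R" by (rule psd_ctrans)
  then have "R * N = N * ctrans R"
    using psd_ctrans[OF N] by (simp add: ctrans_mult[of _ n n _ n])
  with \<open>psd n (N * ctrans R)\<close> show ?thesis by simp
qed

text \<open>With \<open>F\<close> the inverse of \<open>1 + E * Z\<close>, the larger matrix factors
  as \<open>(1 + D * (Z * F)) * (1 + E * Z)\<close>. Since \<open>Z * F\<close> is psd, the extra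
  factor has determinant at least 1.\<close>

lemma det_one_plus_psd_mono:
  assumes E: "psd n E" and D: "psd n D" and Z: "psd n Z"
  shows "Re (det (1\<^sub>m n + E * Z)) \<le> Re (det (1\<^sub>m n + (E + D) * Z))"
proof -
  note c [simp] = E[THEN psd_carrier] D[THEN psd_carrier] Z[THEN psd_carrier]
  obtain F where F [simp]: "F \<in> carrier_mat n n" and inv: "(1\<^sub>m n + E * Z) * F = 1\<^sub>m n" "F * (1\<^sub>m n + E * Z) = 1\<^sub>m n"
    using resolvent_exists[OF E Z] by metis
  have "1\<^sub>m n + (E + D) * Z = 1\<^sub>m n + E * Z + D * Z * (F * (1\<^sub>m n + E * Z))"
    by (simp add: inv ring add_ac)
  also have "\<dots> = (1\<^sub>m n + D * (Z * F)) * (1\<^sub>m n + E * Z)"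
    by (simp add: ring add_ac)
  finally have *: "det (1\<^sub>m n + (E + D) * Z) = det (1\<^sub>m n + D * (Z * F)) * det (1\<^sub>m n + E * Z)"
    by (simp add: det_mult[of _ n])
  have ZF: "psd n (Z * F)" using psd_mult_resolvent[OF Z E F inv(1)] .
  have "1 * Re (det (1\<^sub>m n + E * Z)) \<le> Re (det (1\<^sub>m n + D * (Z * F))) * Re (det (1\<^sub>m n + E * Z))"
    using det_one_plus_psd_mult[OF D ZF] det_one_plus_psd_mult[OF E Z] by (intro mult_right_mono) auto
  also have "\<dots> = Re (det (1\<^sub>m n + (E + D) * Z))"
    using det_one_plus_psd_mult[OF D ZF] by (simp add: * complex_is_Real_iff)
  finally show ?thesis by simp
qed

text \<open>With \<open>Z = (1 + X * M) * Zt * (1 + M * X)\<close> this bounds the reflected matrix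
  \<open>W = Zt * V\<close> by \<open>X + Z\<close>.\<close>

lemma reflection_le:
  assumes M: "psd n M" and X: "psd n X" and Zt: "psd n Zt"
    and V: "V \<in> carrier_mat n n" "(1\<^sub>m n + M * X * M * Zt) * V = 1\<^sub>m n"
      "ctrans V * (1\<^sub>m n + Zt * (M * X * M)) = 1\<^sub>m n"
  shows "psd n (X + (1\<^sub>m n + X * M) * Zt * (1\<^sub>m n + M * X) - Zt * V)"
proof -
  note c [simp] = M[THEN psd_carrier] X[THEN psd_carrier] Zt[THEN psd_carrier] V(1)
  note h [simp] = M[THEN psd_ctrans] X[THEN psd_ctrans] Zt[THEN psd_ctrans]
  \<comment> \<open>Each primed matrix is the adjoint of the unprimed one, and \<open>J\<close> is
    the matrix inverted by \<open>V\<close>.\<close>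
  define L where "L = 1\<^sub>m n + M * X"
  define L' where "L' = 1\<^sub>m n + X * M"
  define p where "p = M * Zt"
  define p' where "p' = Zt * M"
  define J where "J = 1\<^sub>m n + M * (X * p)"
  define J' where "J' = 1\<^sub>m n + p' * (X * M)"
  define A where "A = J + p"
  define A' where "A' = J' + p'"
  have c' [simp]: "L \<in> carrier_mat n n" "L' \<in> carrier_mat n n" "p \<in> carrier_mat n n" "p' \<in> carrier_mat n n"
    "J \<in> carrier_mat n n" "J' \<in> carrier_mat n n" "A \<in> carrier_mat n n" "A' \<in> carrier_mat n n"
    by (simp_all add: L_def L'_def p_def p'_def J_def J'_def A_def A'_def)
  have 1: "L * J = 1\<^sub>m n + M * (X * A)"
    by (simp add: L_def A_def J_def ring add_ac)
  have 2: "J' * L' = 1\<^sub>m n + A' * (X * M)"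
    by (simp add: L'_def A'_def J'_def ring add_ac)
  have "J' * (L' * (Zt * (L * J))) = (J' * L') * (Zt * (L * J))"
    by (simp add: ring)
  also have "\<dots> = Zt + A' * (X * p) + p' * (X * A) + A' * (X * (M * (Zt * (M * (X * A)))))"
    unfolding 1 2 by (simp add: p_def p'_def ring add_ac)
  finally have 3: "J' * (L' * (Zt * (L * J))) =
    Zt + A' * (X * p) + p' * (X * A) + A' * (X * (M * (Zt * (M * (X * A)))))" .
  have 4: "J' * (X * J) + Zt + A' * (X * p) + p' * (X * A) = J' * Zt + A' * (X * A)"
  proof -
    have "J' * Zt = Zt + p' * (X * p)" by (simp add: J'_def p_def ring)
    then show ?thesis by (simp add: A_def A'_def ring add_ac)
  qed
  \<comment> \<open>The target is \<open>?Y - Zt * V = ctrans (A * V) * ?C * (A * V)\<close> with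
    \<open>?C\<close> psd. To keep inverses out of the expansion, the polynomial identity
    \<open>J' * ?Y * J = J' * Zt + A' * ?C * A\<close> is proved first and then multiplied by
    \<open>ctrans V\<close> and \<open>V\<close>.\<close>
  let ?C = "X + X * (M * (Zt * (M * X)))"
  let ?Y = "X + L' * (Zt * L)"
  have J: "J * V = 1\<^sub>m n" "ctrans V * J' = 1\<^sub>m n"
    using V by (simp_all add: J_def J'_def p_def p'_def ring)
  have cancel: "J * (V * B) = B" "ctrans V * (J' * B) = B" if "B \<in> carrier_mat n n" for B
    using that J by (simp_all flip: ring(1))
  have "J' * (?Y * J) = J' * (X * J) + J' * (L' * (Zt * (L * J)))"
    by (simp add: ring)
  also have "\<dots> = (J' * (X * J) + Zt + A' * (X * p) + p' * (X * A)) + A' * (X * (M * (Zt * (M * (X * A)))))"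
    unfolding 3 by (simp add: assoc_add_mat[of _ n n])
  also have "\<dots> = J' * Zt + A' * (?C * A)"
    unfolding 4 by (simp add: ring assoc_add_mat[of _ n n])
  finally have "ctrans V * (J' * (?Y * J)) * V = ctrans V * (J' * Zt + A' * (?C * A)) * V"
    by simp
  then have "?Y = Zt * V + ctrans V * A' * ?C * (A * V)"
    by (simp add: ring cancel J)
  then have "?Y - Zt * V = ctrans V * A' * ?C * (A * V)"
    by (simp add: add_diff)
  moreover have "ctrans (A * V) = ctrans V * A'"
    by (simp add: A_def A'_def J_def J'_def p_def p'_def ctrans_add[of _ n n] ctrans_mult[of _ n n _ n] ring)
  moreover have "psd n ?C"
    using psd_add[OF X psd_congruence[OF Zt, of "M * X" n]]
    by (simp add: ctrans_mult[of _ n n _ n] ring)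
  then have "psd n (ctrans (A * V) * ?C * (A * V))"
    by (rule psd_congruence) simp
  ultimately show ?thesis
    by (simp add: L_def L'_def ring)
qed

lemma det_one_plus_psd_of_real:
  assumes "psd n P" "psd n Q"
  shows "det (1\<^sub>m n + P * Q) = of_real (Re (det (1\<^sub>m n + P * Q)))"
  using det_one_plus_psd_mult(1)[OF assms] by simp

text \<open>Put \<open>K = M - N\<close> and \<open>T = X * Q\<close>. Then
  \<open>(1 + M * X) * Q\<close> collapses to \<open>1 + K * T\<close>, and the resolvent relation
  \<open>T + T * N * X = X\<close> removes the remaining occurrences of \<open>T\<close>.\<close>

lemma resolvent_congruence:
  assumes N: "psd n N" and X: "psd n X" and M: "M \<in> carrier_mat n n"
    and Q: "Q \<in> carrier_mat n n" "(1\<^sub>m n + N * X) * Q = 1\<^sub>m n" "Q * (1\<^sub>m n + N * X) = 1\<^sub>m n"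
       "ctrans Q * (1\<^sub>m n + X * N) = 1\<^sub>m n"
  shows "M * X * M + N =
    (1\<^sub>m n + M * X) * (Q * N) * (1\<^sub>m n + X * M) + (M - N) * (X * Q) * (M - N)"
proof -
  define K where "K = M - N"
  define T where "T = X * Q"
  note c [simp] = N[THEN psd_carrier] X[THEN psd_carrier] M Q(1)
  have K [simp]: "K \<in> carrier_mat n n" and T [simp]: "T \<in> carrier_mat n n" unfolding K_def T_def by (auto intro: minus_carrier_mat)
  have M_eq: "M = N + K" by (rule eq_matI) (simp_all add: K_def carrier_matD[OF c(1)] carrier_matD[OF M])
  have T1: "T + T * (N * X) = X"
  proof -
    have "T + T * (N * X) = X * (Q * (1\<^sub>m n + N * X))" by (simp add: T_def ring)
    then show ?thesis by (simp add: Q)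
  qed
  have T1': "T * B + T * (N * (X * B)) = X * B" if "B \<in> carrier_mat n n" for B
    using arg_cong[OF T1, of "\<lambda>A. A * B"] that by (simp add: ring)
  have Q1: "(1\<^sub>m n + M * X) * Q = 1\<^sub>m n + K * T"
  proof -
    have "(1\<^sub>m n + M * X) * Q = (1\<^sub>m n + N * X) * Q + K * T"
      by (simp add: M_eq T_def ring add_ac)
    then show ?thesis by (simp add: Q)
  qed
  have "(1\<^sub>m n + M * X) * (Q * N) * (1\<^sub>m n + X * M) = ((1\<^sub>m n + M * X) * Q) * (N * (1\<^sub>m n + X * M))"
    by (simp add: ring)
  also have "\<dots> = N + N * (X * N) + N * (X * K) + K * (T * N + T * (N * (X * N))) + K * (T * (N * (X * K)))"
    unfolding Q1 by (simp add: M_eq ring add_ac)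
  also have "\<dots> = N + N * (X * N) + N * (X * K) + K * (X * N) + K * (T * (N * (X * K)))"
    by (simp add: T1')
  finally have "(1\<^sub>m n + M * X) * (Q * N) * (1\<^sub>m n + X * M) + K * T * K =
     N + N * (X * N) + N * (X * K) + K * (X * N) + K * (T * (N * (X * K))) + K * (T * K)"
    by (simp add: assoc_mult_mat[of _ n n _ n _ n])
  also have "\<dots> = N + N * (X * N) + N * (X * K) + K * (X * N) + K * (T * K + T * (N * (X * K)))"
    by (simp add: ring add_ac)
  also have "\<dots> = M * X * M + N"
    unfolding T1'[OF K] by (simp add: M_eq ring add_ac)
  finally show ?thesis unfolding K_def T_def by simp
qed

section \<open>Monotonicity, shift and reflection of the gain\<close>

lemma gain_nonneg: "psd n M \<Longrightarrow> psd n S \<Longrightarrow> 0 \<le> gain M S"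
  using det_one_plus_psd_mult(2)[of n M S] psd_carrier[of n M] by (auto simp: gain_def)

lemma gain_mono:
  assumes "psd n M" "psd n S" "psd n D"
  shows "gain M S \<le> gain M (S + D)"
proof -
  note c [simp] = assms[THEN psd_carrier]
  have "det (1\<^sub>m n + M * S) = det (1\<^sub>m n + S * M)" "det (1\<^sub>m n + M * (S + D)) = det (1\<^sub>m n + (S + D) * M)"
    by (simp_all add: det_one_plus_mult_commute[of _ n n])
  then show ?thesis
    using det_one_plus_psd_mono[OF assms(2,3,1)] det_one_plus_psd_mult(2)[OF assms(1,2)]
    by (simp add: gain_def carrier_matD[OF c(1)])
qed

text \<open>The shifted channel is \<open>M' = (1 + M * B)\<inverse> * M\<close>: interference with covariance \<open>B\<close>
  is absorbed into the noise.\<close>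

lemma gain_shift:
  assumes M: "psd n M" and B: "psd n B"
  obtains M' where "psd n M'" "\<And>X. psd n X \<Longrightarrow> gain M (B + X) = gain M B + gain M' X"
proof -
  note c [simp] = M[THEN psd_carrier] B[THEN psd_carrier]
  obtain Q where Q: "Q \<in> carrier_mat n n" "(1\<^sub>m n + M * B) * Q = 1\<^sub>m n" "Q * (1\<^sub>m n + M * B) = 1\<^sub>m n"
    using resolvent_exists[OF M B] by metis
  note cQ [simp] = Q(1)
  have QM: "psd n (Q * M)" using psd_resolvent_mult[OF B M Q(1,3)] .
  have "gain M (B + X) = gain M B + gain (Q * M) X" if X: "psd n X" for X
  proof -
    note cX [simp] = X[THEN psd_carrier]
    have "(1\<^sub>m n + M * B) * (1\<^sub>m n + Q * M * X) = 1\<^sub>m n + M * B + ((1\<^sub>m n + M * B) * Q) * (M * X)"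
      by (simp add: ring)
    also have "\<dots> = 1\<^sub>m n + M * (B + X)"
      unfolding Q(2) by (simp add: ring add_ac)
    finally have "det (1\<^sub>m n + M * (B + X)) = det (1\<^sub>m n + M * B) * det (1\<^sub>m n + Q * M * X)"
      using det_mult[of "1\<^sub>m n + M * B" n "1\<^sub>m n + Q * M * X"] by simp
    then have "Re (det (1\<^sub>m n + M * (B + X))) = Re (det (1\<^sub>m n + M * B)) * Re (det (1\<^sub>m n + Q * M * X))"
      using det_one_plus_psd_mult(1)[OF M B] by (simp add: complex_is_Real_iff)
    moreover have "0 < Re (det (1\<^sub>m n + M * B))" "0 < Re (det (1\<^sub>m n + Q * M * X))"
      using det_one_plus_psd_mult(2)[OF M B] det_one_plus_psd_mult(2)[OF QM X] by linarith+
    ultimately show ?thesis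
      using carrier_matD(1)[OF c(1)] carrier_matD(1)[OF Q(1)] by (simp add: gain_def ln_mult)
  qed
  with QM show thesis by (rule that)
qed

text \<open>In the coordinate \<open>T(S) = S * (1 + M * S)\<inverse>\<close> the matrix \<open>W\<close> is the reflection
  \<open>T(W) = T(X + Z) - T(X)\<close>. Since
  \<open>det (1 + N * S) / det (1 + M * S) = det (1 + (N - M) * T(S))\<close>, the claim says that
  \<open>ln (det (1 + (N - M) * T))\<close> is subadditive along this splitting.\<close>

lemma reflection_exists:
  assumes M: "psd n M" and X: "psd n X" and Z: "psd n Z"
  obtains W where "psd n W" "psd n (X + Z - W)"
    "\<And>N. psd n N \<Longrightarrow>
      gain M X + gain M W + gain N (X + Z) \<le> gain N X + gain N W + gain M (X + Z)"
proof -
  note c [simp] = M[THEN psd_carrier] X[THEN psd_carrier] Z[THEN psd_carrier]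
  note h = M[THEN psd_ctrans] X[THEN psd_ctrans] Z[THEN psd_ctrans]
  obtain R where R [simp]: "R \<in> carrier_mat n n" "(1\<^sub>m n + M * X) * R = 1\<^sub>m n" "R * (1\<^sub>m n + M * X) = 1\<^sub>m n"
    "ctrans R * (1\<^sub>m n + X * M) = 1\<^sub>m n" "(1\<^sub>m n + X * M) * ctrans R = 1\<^sub>m n"
    using resolvent_exists[OF M X] by metis
  define Zt where "Zt = ctrans R * Z * R"
  have Zt: "psd n Zt" unfolding Zt_def by (rule psd_congruence[OF Z R(1)])
  note cZt [simp] = Zt[THEN psd_carrier]
  define L where "L = 1\<^sub>m n + M * X"
  define L' where "L' = 1\<^sub>m n + X * M"
  have L [simp]: "L \<in> carrier_mat n n" "L' \<in> carrier_mat n n" by (simp_all add: L_def L'_def)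
  have Z_eq: "Z = L' * (Zt * L)"
  proof -
    have "L' * (Zt * L) = (L' * ctrans R) * Z * (R * L)" by (simp add: Zt_def ring)
    then show ?thesis by (simp add: L_def L'_def)
  qed
  have LM: "M * L' = L * M" by (simp add: L_def L'_def ring)
  define S where "S = M * X * M"
  have S: "psd n S" using psd_congruence[OF X c(1)] by (simp add: S_def h)
  note cS [simp] = S[THEN psd_carrier]
  obtain V where V [simp]: "V \<in> carrier_mat n n" "(1\<^sub>m n + S * Zt) * V = 1\<^sub>m n" "V * (1\<^sub>m n + S * Zt) = 1\<^sub>m n"
    "ctrans V * (1\<^sub>m n + Zt * S) = 1\<^sub>m n" "(1\<^sub>m n + Zt * S) * ctrans V = 1\<^sub>m n"
    using resolvent_exists[OF S Zt] by metis
  \<comment> \<open>In the coordinate \<open>T\<close>, the difference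
    \<open>T(X + Z) - T(X)\<close> equals \<open>Zt\<close> times the inverse of
    \<open>1 + (S + M) * Zt\<close>. Because \<open>V\<close> inverts \<open>1 + S * Zt\<close>,
    \<open>T(W)\<close> takes the same value. \<open>Z\<close> itself need not be
    invertible.\<close>
  define W where "W = Zt * V"
  have W: "psd n W" unfolding W_def by (rule psd_mult_resolvent[OF Zt S]) simp_all
  note cW [simp] = W[THEN psd_carrier]
  have WJ: "W * (1\<^sub>m n + S * Zt) = Zt"
    by (simp add: W_def ring(1))
  have Y: "psd n (X + Z)" by (rule psd_add[OF X Z])
  have YW: "psd n (X + Z - W)"
    using reflection_le[OF M X Zt V(1)] V(2,4)
    by (simp add: Z_eq W_def S_def L_def L'_def ring(1))
  \<comment> \<open>Multiplying by \<open>1 + S * Zt\<close> clears the resolvent hidden in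
    \<open>W\<close>. This is used both for \<open>M\<close> and for the arbitrary \<open>N\<close>
    of the claim.\<close>
  have detW: "det (1\<^sub>m n + N * W) * det (1\<^sub>m n + S * Zt) = det (1\<^sub>m n + (S + N) * Zt)"
    if [simp]: "N \<in> carrier_mat n n" for N
  proof -
    have "(1\<^sub>m n + N * W) * (1\<^sub>m n + S * Zt) = 1\<^sub>m n + S * Zt + N * (W * (1\<^sub>m n + S * Zt))"
      by (simp add: ring add_ac)
    also have "\<dots> = 1\<^sub>m n + (S + N) * Zt"
      unfolding WJ by (simp add: ring add_ac)
    finally show ?thesis by (simp flip: det_mult[of _ n])
  qed
  have detMY: "det (1\<^sub>m n + M * (X + Z)) = det (1\<^sub>m n + (S + M) * Zt) * det L"
  proof -
    have "(1\<^sub>m n + (S + M) * Zt) * L = L + L * M * (Zt * L)"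
      by (simp add: L_def S_def ring add_ac)
    also have "\<dots> = L + M * Z"
      unfolding Z_eq by (simp add: LM[symmetric] ring(1))
    also have "\<dots> = 1\<^sub>m n + M * (X + Z)"
      by (simp add: L_def ring add_ac)
    finally show ?thesis by (simp flip: det_mult[of _ n])
  qed
  show thesis
  proof (rule that[OF W YW])
    fix N assume N: "psd n N"
    note cN [simp] = N[THEN psd_carrier]
    obtain Q where Q: "Q \<in> carrier_mat n n" "(1\<^sub>m n + N * X) * Q = 1\<^sub>m n" "Q * (1\<^sub>m n + N * X) = 1\<^sub>m n"
      "ctrans Q * (1\<^sub>m n + X * N) = 1\<^sub>m n"
      using resolvent_exists[OF N X] by metis
    note cQ [simp] = Q(1)
    have QN: "psd n (Q * N)" using psd_resolvent_mult[OF X N Q(1,3)] .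
    have detNY: "det (1\<^sub>m n + N * (X + Z)) = det (1\<^sub>m n + N * X) * det (1\<^sub>m n + L * (Q * N) * L' * Zt)"
    proof -
      have "1\<^sub>m n + N * (X + Z) = 1\<^sub>m n + N * X + ((1\<^sub>m n + N * X) * Q) * (N * Z)"
        unfolding Q(2) by (simp add: ring add_ac)
      also have "\<dots> = (1\<^sub>m n + N * X) * (1\<^sub>m n + (Q * N * L' * Zt) * L)"
        by (simp add: Z_eq ring)
      finally have "det (1\<^sub>m n + N * (X + Z)) = det (1\<^sub>m n + N * X) * det (1\<^sub>m n + (Q * N * L' * Zt) * L)"
        by (simp add: det_mult[of _ n])
      also have "det (1\<^sub>m n + (Q * N * L' * Zt) * L) = det (1\<^sub>m n + L * (Q * N * L' * Zt))"
        by (rule det_one_plus_mult_commute[of _ n n]) simp_all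
      finally show ?thesis by (simp add: ring)
    qed
    \<comment> \<open>\<open>E\<close> is what the channel \<open>N\<close> sees of
      \<open>Zt\<close> once \<open>X\<close> is absorbed into the noise. By
      \<open>resolvent_congruence\<close> it falls short of \<open>S + N\<close> exactly by the psd
      matrix \<open>D\<close>.\<close>
    define E where "E = L * (Q * N) * L'"
    define D where "D = (M - N) * (X * Q) * (M - N)"
    have "ctrans L' = L" by (simp add: L_def L'_def h ctrans_add[of _ n n] ctrans_mult[of _ n n _ n])
    then have E: "psd n E" unfolding E_def using psd_congruence[OF QN L(2)] by simp
    have [simp]: "M - N \<in> carrier_mat n n" by (auto intro: minus_carrier_mat)
    have "ctrans (M - N) = M - N" using h psd_ctrans[OF N] by (simp add: ctrans_minus[of _ n n])
    then have D: "psd n D"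
      unfolding D_def using psd_congruence[OF psd_mult_resolvent[OF X N Q(1,2)], of "M - N" n] by simp
    have SN: "S + N = E + D"
      unfolding S_def E_def D_def L_def L'_def by (rule resolvent_congruence[OF N X c(1) Q])
    define d where "d A B = Re (det (1\<^sub>m n + A * B))" for A B
    have d: "det (1\<^sub>m n + A * B) = of_real (d A B)" if "psd n A" "psd n B" for A B
      using det_one_plus_psd_of_real[OF that] by (simp add: d_def)
    have pos: "0 < d A B" if "psd n A" "psd n B" for A B
      using det_one_plus_psd_mult(2)[OF that] by (simp add: d_def)
    have g: "gain A B = ln (d A B)" if "psd n A" for A B
      using psd_carrier[OF that] by (auto simp: gain_def d_def)
    note P = M N X Z W S Zt Y E D psd_add
    have eqM: "d M (X + Z) = d M W * d S Zt * d M X"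
      using detMY[folded detW[OF c(1)]] unfolding L_def by (simp add: d P flip: of_real_mult)
    have eqW: "d N W * d S Zt = d (S + N) Zt"
      using detW[OF cN] by (simp add: d P flip: of_real_mult)
    have eqN: "d N (X + Z) = d N X * d E Zt"
      using detNY unfolding E_def[symmetric] by (simp add: d P flip: of_real_mult)
    \<comment> \<open>After substituting \<open>eqM\<close> and \<open>eqN\<close>, the factors
      \<open>d M X\<close>, \<open>d M W\<close> and \<open>d N X\<close> cancel from the
      exponentiated claim; by \<open>eqW\<close> this inequality is all that remains.\<close>
    have "d E Zt \<le> d (S + N) Zt"
      unfolding SN d_def by (rule det_one_plus_psd_mono[OF E D Zt])
    then have "ln (d E Zt) \<le> ln (d N W) + ln (d S Zt)"
      unfolding eqW[symmetric] by (subst ln_mult_pos[symmetric]) (simp_all add: pos P)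
    moreover have "ln (d M (X + Z)) = ln (d M W) + ln (d S Zt) + ln (d M X)"
      unfolding eqM by (simp add: pos P ln_mult_pos)
    moreover have "ln (d N (X + Z)) = ln (d N X) + ln (d E Zt)"
      unfolding eqN by (simp add: pos P ln_mult_pos)
    ultimately show "gain M X + gain M W + gain N (X + Z) \<le> gain N X + gain N W + gain M (X + Z)"
      by (simp add: g P)
  qed
qed

end

subsection \<open>The exchange argument\<close>

text \<open>Sylvester's identity, applied twice, trades \<open>H * S * ctrans H\<close> for the Gram
  matrix. Receivers with different numbers of antennas then all act through matrices of one
  size.\<close>

lemma logdet_gain_eq_gain:
  assumes H: "H \<in> carrier_mat m n" and S: "S \<in> carrier_mat n n"
  shows "logdet_gain H S = gain (ctrans H * H) S"
proof -
  have "det (1\<^sub>m m + H * S * ctrans H) = det (1\<^sub>m m + H * (S * ctrans H))"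
    using H S by (simp add: assoc_mult_mat[of _ m n _ n _ m])
  also have "\<dots> = det (1\<^sub>m n + (S * ctrans H) * H)"
    by (rule det_one_plus_mult_commute) (use H S in auto)
  also have "\<dots> = det (1\<^sub>m n + S * (ctrans H * H))"
    using H S by (simp add: assoc_mult_mat[of _ n n _ m _ n])
  also have "\<dots> = det (1\<^sub>m n + (ctrans H * H) * S)"
    by (rule det_one_plus_mult_commute) (use H S in auto)
  finally show ?thesis
    using H by (simp add: logdet_gain_def gain_def)
qed

section \<open>Psd matrices of bounded trace\<close>

lemma psd_form_nonneg:
  "psd n S \<Longrightarrow> 0 \<le> Re (\<Sum>i<n. \<Sum>j<n. cnj (v i) * S $$ (i,j) * v j)"
  by (simp add: psd_def)

lemma psd_diag_nonneg:
  assumes "psd n S" "i < n"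
  shows "0 \<le> Re (S $$ (i,i))"
proof -
  let ?v = "\<lambda>k. if k = i then 1 else (0::complex)"
  have "(\<Sum>k<n. \<Sum>l<n. cnj (?v k) * S $$ (k,l) * ?v l) = S $$ (i,i)"
    using assms(2) by (simp add: if_distrib[of cnj] if_distrib[of "\<lambda>x. x * _"] if_distrib[of "\<lambda>x. _ * x"]
        sum.delta cong: if_cong)
  then show ?thesis using psd_form_nonneg[OF assms(1), of ?v] by simp
qed

lemma psd_trace_nonneg: "psd n S \<Longrightarrow> 0 \<le> Re (mtrace S)"
  using psd_diag_nonneg[of n S] psd_carrier[of n S] by (auto simp: mtrace_def intro!: sum_nonneg)

text \<open>The form is nonnegative at \<open>a e_i - b e_j\<close>, and Hermitian symmetry gives
  the two cross terms equal real parts.\<close>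

lemma psd_offdiag_le:
  assumes S: "psd n S" and ij: "i < n" "j < n"
  shows "2 * Re (cnj a * S $$ (i,j) * b) \<le> (cmod a)\<^sup>2 * Re (S $$ (i,i)) + (cmod b)\<^sup>2 * Re (S $$ (j,j))"
proof -
  define B where "B x y = (\<Sum>k<n. \<Sum>l<n. cnj (x k) * S $$ (k,l) * y l)" for x y :: "nat \<Rightarrow> complex"
  define u where "u i a k = (if k = i then a else 0)" for i k :: nat and a :: complex
  have u: "B (u p c) (u q d) = cnj c * S $$ (p,q) * d" if "p < n" "q < n" for p q c d
    using that unfolding B_def u_def
    by (simp add: if_distrib[of cnj] if_distrib[of "\<lambda>x. x * _"] if_distrib[of "\<lambda>x. _ * x"]
        sum.delta cong: if_cong)
  let ?v = "\<lambda>k. u i a k - u j b k"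
  have "B ?v ?v = B (u i a) (u i a) - B (u i a) (u j b) - B (u j b) (u i a) + B (u j b) (u j b)"
    unfolding B_def by (simp add: algebra_simps sum.distrib sum_subtractf)
  then have "Re (B ?v ?v) = Re (cnj a * S $$ (i,i) * a) - Re (cnj a * S $$ (i,j) * b)
      - Re (cnj b * S $$ (j,i) * a) + Re (cnj b * S $$ (j,j) * b)"
    by (simp only: u ij minus_complex.sel plus_complex.sel)
  moreover have "0 \<le> Re (B ?v ?v)"
    unfolding B_def by (rule psd_form_nonneg[OF S])
  moreover have S_swap: "S $$ (j,i) = cnj (S $$ (i,j))"
    using arg_cong[OF psd_ctrans[OF S], of "\<lambda>A. A $$ (j,i)"] psd_carrier[OF S] ij
    by (simp add: ctrans_def)
  then have "Re (cnj b * S $$ (j,i) * a) = Re (cnj a * S $$ (i,j) * b)"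
    by (simp add: algebra_simps)
  moreover have diag: "Re (cnj c * S $$ (p,p) * c) = (cmod c)\<^sup>2 * Re (S $$ (p,p))" for c p
    unfolding cmod_power2 by (simp add: power2_eq_square algebra_simps)
  ultimately show ?thesis using diag[of a i] diag[of b j] by linarith
qed

text \<open>Summing \<open>psd_offdiag_le\<close> over all entries bounds the form by
  \<open>n\<close> times its diagonal part, and each diagonal entry is at most the trace. The
  constant \<open>n * P\<close> is cruder than \<open>P\<close>, but any bound independent of
  \<open>S\<close> serves to make the suprema finite.\<close>

lemma psd_trace_bound:
  assumes S: "psd n S" and tr: "Re (mtrace S) \<le> P"
  shows "psd n (complex_of_real (n * P) \<cdot>\<^sub>m 1\<^sub>m n - S)"
proof -
  note c = psd_carrier[OF S]
  let ?C = "complex_of_real (n * P) \<cdot>\<^sub>m 1\<^sub>m n :: complex mat"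
  have diag: "Re (S $$ (i,i)) \<le> P" if "i < n" for i
  proof -
    have "Re (S $$ (i,i)) \<le> (\<Sum>i<n. Re (S $$ (i,i)))"
      using that psd_diag_nonneg[OF S] by (intro member_le_sum) auto
    then show ?thesis using tr c by (simp add: mtrace_def)
  qed
  have "ctrans (?C - S) = ?C - S"
  proof -
    have "ctrans ?C = ?C" by (rule eq_matI) (auto simp: ctrans_def)
    then show ?thesis using c psd_ctrans[OF S] by (simp add: ctrans_minus[of _ n n])
  qed
  moreover have "0 \<le> Re (\<Sum>i<n. \<Sum>j<n. cnj (v i) * (?C - S) $$ (i,j) * v j)" for v
  proof -
    define s where "s i = (cmod (v i))\<^sup>2 * Re (S $$ (i,i))" for i
    have "(\<Sum>i<n. \<Sum>j<n. cnj (v i) * (?C - S) $$ (i,j) * v j) =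
       (\<Sum>i<n. \<Sum>j<n. (if i = j then complex_of_real (n * P) * (cnj (v i) * v j) else 0) - cnj (v i) * S $$ (i,j) * v j)"
      using c by (intro sum.cong) (auto simp: algebra_simps)
    also have "\<dots> = (\<Sum>i<n. complex_of_real (n * P) * (cnj (v i) * v i)) - (\<Sum>i<n. \<Sum>j<n. cnj (v i) * S $$ (i,j) * v j)"
      by (simp add: sum_subtractf)
    also have "(\<Sum>i<n. complex_of_real (n * P) * (cnj (v i) * v i)) = of_real (n * (\<Sum>i<n. P * (cmod (v i))\<^sup>2))"
    proof -
      have "complex_of_real (n * P) * (cnj (v i) * v i) = of_real (n * (P * (cmod (v i))\<^sup>2))" for i
        unfolding of_real_mult complex_norm_square by (simp add: mult_ac)
      then show ?thesis by (simp only: of_real_sum sum_distrib_left)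
    qed
    finally have eq: "Re (\<Sum>i<n. \<Sum>j<n. cnj (v i) * (?C - S) $$ (i,j) * v j) =
       n * (\<Sum>i<n. P * (cmod (v i))\<^sup>2) - (\<Sum>i<n. \<Sum>j<n. Re (cnj (v i) * S $$ (i,j) * v j))"
      by simp
    have "(\<Sum>i<n. \<Sum>j<n. Re (cnj (v i) * S $$ (i,j) * v j)) \<le> (\<Sum>i<n. \<Sum>j<n. (s i + s j) / 2)"
    proof (intro sum_mono)
      fix i j assume "i \<in> {..<n}" "j \<in> {..<n}"
      then have "2 * Re (cnj (v i) * S $$ (i,j) * v j) \<le> s i + s j"
        unfolding s_def by (intro psd_offdiag_le[OF S]) auto
      then show "Re (cnj (v i) * S $$ (i,j) * v j) \<le> (s i + s j) / 2"
        by (simp only: le_divide_eq_numeral1 mult.commute)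
    qed
    also have "\<dots> = n * (\<Sum>i<n. s i)"
      by (simp add: sum.distrib add_divide_distrib sum_distrib_left flip: sum_divide_distrib)
    also have "\<dots> \<le> n * (\<Sum>i<n. P * (cmod (v i))\<^sup>2)"
      unfolding s_def using diag
      by (intro mult_left_mono sum_mono) (auto simp: mult.commute intro: mult_right_mono)
    finally show ?thesis unfolding eq by simp
  qed
  ultimately show ?thesis
    using c unfolding psd_def by (auto intro: minus_carrier_mat)
qed

section \<open>Tail covariances\<close>

lemma tail_cov_carrier [simp]: "tail_cov nt K ord Q k \<in> carrier_mat nt nt"
  by (simp add: tail_cov_def)

lemma tail_cov_ge: "K \<le> k \<Longrightarrow> tail_cov nt K ord Q k = 0\<^sub>m nt nt"
  by (rule eq_matI) (auto simp: tail_cov_def)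

lemma tail_cov_Suc:
  "k < K \<Longrightarrow> Q (ord k) \<in> carrier_mat nt nt \<Longrightarrow>
    tail_cov nt K ord Q k = Q (ord k) + tail_cov nt K ord Q (Suc k)"
  by (rule eq_matI) (auto simp: tail_cov_def sum.atLeast_Suc_lessThan)

lemma psd_tail_cov:
  assumes "\<And>m. m < K \<Longrightarrow> psd nt (Q (ord m))"
  shows "psd nt (tail_cov nt K ord Q k)"
proof (cases "k \<le> K")
  case True
  then show ?thesis
  proof (induction rule: inc_induct)
    case base
    show ?case by (simp add: tail_cov_ge psd_zero)
  next
    case (step m)
    then show ?case using assms by (simp add: tail_cov_Suc psd_carrier psd_add)
  qed
qed (simp add: tail_cov_ge psd_zero)

lemma mtrace_tail_cov:
  assumes "\<And>m. m < K \<Longrightarrow> Q (ord m) \<in> carrier_mat nt nt"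
  shows "mtrace (tail_cov nt K ord Q k) = (\<Sum>m\<in>{k..<K}. mtrace (Q (ord m)))"
proof -
  have "mtrace (tail_cov nt K ord Q k) = (\<Sum>m\<in>{k..<K}. \<Sum>i<nt. Q (ord m) $$ (i,i))"
    unfolding sum.swap[of _ "{..<nt}"] by (simp add: mtrace_def tail_cov_def)
  also have "\<dots> = (\<Sum>m\<in>{k..<K}. mtrace (Q (ord m)))"
    by (auto simp: mtrace_def carrier_matD(1)[OF assms] intro!: sum.cong)
  finally show ?thesis .
qed

lemma psd_tail_cov_bound:
  assumes Q: "\<And>m. m < K \<Longrightarrow> psd nt (Q (ord m))" and P: "(\<Sum>m<K. Re (mtrace (Q (ord m)))) \<le> P"
  shows "psd nt (complex_of_real (nt * P) \<cdot>\<^sub>m 1\<^sub>m nt - tail_cov nt K ord Q k)"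
proof (rule psd_trace_bound, rule psd_tail_cov, rule Q)
  have "Re (mtrace (tail_cov nt K ord Q k)) = (\<Sum>m\<in>{k..<K}. Re (mtrace (Q (ord m))))"
    using Q psd_carrier by (subst mtrace_tail_cov) auto
  also have "\<dots> \<le> (\<Sum>m<K. Re (mtrace (Q (ord m))))"
    using Q psd_trace_nonneg by (intro sum_mono2) auto
  finally show "Re (mtrace (tail_cov nt K ord Q k)) \<le> P" using P by simp
qed

definition weighted_rate where
  "weighted_rate nt K H G w ord Q = (\<Sum>k<K. w (ord k) * secrecy_rate nt K H G ord Q k)"

lemma phi_eq: "phi nt K H G w P ord = Sup (weighted_rate nt K H G w ord ` {Q. feasible_cov nt K P Q})"
  unfolding phi_def weighted_rate_def by (intro arg_cong[where f = Sup]) auto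

section \<open>Weighted rates: boundedness, exchange and sorting\<close>

locale wiretap_channel =
  fixes K nt ne :: nat and n :: "nat \<Rightarrow> nat"
    and H :: "nat \<Rightarrow> complex mat" and G :: "complex mat"
    and w :: "nat \<Rightarrow> real" and P :: real
  assumes H: "\<And>k. k < K \<Longrightarrow> H k \<in> carrier_mat (n k) nt"
    and G: "G \<in> carrier_mat ne nt"
    and P: "P > 0"
    and w: "\<And>k. k < K \<Longrightarrow> w k \<ge> 0"
begin

abbreviation M :: "nat \<Rightarrow> complex mat" where "M k \<equiv> ctrans (H k) * H k"
abbreviation N :: "complex mat" where "N \<equiv> ctrans G * G"

lemma psd_M: "k < K \<Longrightarrow> psd nt (M k)" and psd_N: "psd nt N"
  using psd_gram H G by blast+

lemma secrecy_rate_eq: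
  assumes "ord k < K"
  shows "secrecy_rate nt K H G ord Q k =
    (gain (M (ord k)) (tail_cov nt K ord Q k) - gain (M (ord k)) (tail_cov nt K ord Q (Suc k)))
    - (gain N (tail_cov nt K ord Q k) - gain N (tail_cov nt K ord Q (Suc k)))"
  unfolding secrecy_rate_def
  by (simp add: logdet_gain_eq_gain[OF H[OF assms] tail_cov_carrier] logdet_gain_eq_gain[OF G tail_cov_carrier])

text \<open>Real suprema can be compared only for sets bounded above. A rate is at most the
  receiver's gain at its own tail: the subtracted gain is nonnegative, and so is the eavesdropper's
  difference, by monotonicity. The tail lies below a fixed multiple of the identity.\<close>

lemma bdd_above_weighted_rate:
  assumes ord: "ord permutes {..<K}"
  shows "bdd_above (weighted_rate nt K H G w ord ` {Q. feasible_cov nt K P Q})"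
proof (rule bdd_aboveI2)
  fix Q assume "Q \<in> {Q. feasible_cov nt K P Q}"
  then have Q: "\<And>k. k < K \<Longrightarrow> psd nt (Q k)" and tr: "(\<Sum>k<K. Re (mtrace (Q k))) \<le> P"
    by (auto simp: feasible_cov_def)
  have ord_less: "ord k < K" if "k < K" for k
    using permutes_in_image[OF ord, of k] that by simp
  have tr': "(\<Sum>k<K. Re (mtrace (Q (ord k)))) \<le> P"
    using tr by (simp add: sum.permute[OF ord, of "\<lambda>k. Re (mtrace (Q k))"] o_def)
  let ?C = "complex_of_real (nt * P) \<cdot>\<^sub>m 1\<^sub>m nt"
  let ?S = "tail_cov nt K ord Q"
  have S: "psd nt (?S k)" for k
    using Q ord_less by (intro psd_tail_cov) auto
  show "weighted_rate nt K H G w ord Q \<le> (\<Sum>k<K. w (ord k) * gain (M (ord k)) ?C)"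
    unfolding weighted_rate_def
  proof (intro sum_mono mult_left_mono)
    fix k assume "k \<in> {..<K}"
    then have k: "k < K" by simp
    have "psd nt (?C - ?S k)"
      using Q ord_less tr' by (intro psd_tail_cov_bound) auto
    then have "gain (M (ord k)) (?S k) \<le> gain (M (ord k)) (?S k + (?C - ?S k))"
      by (rule gain_mono[OF psd_M[OF ord_less[OF k]] S])
    also have "?S k + (?C - ?S k) = ?C"
      using carrier_matD[OF tail_cov_carrier] by (intro eq_matI) auto
    finally have 1: "gain (M (ord k)) (?S k) \<le> gain (M (ord k)) ?C" .
    have 2: "0 \<le> gain (M (ord k)) (?S (Suc k))"
      by (rule gain_nonneg[OF psd_M[OF ord_less[OF k]] S])
    have "gain N (?S (Suc k)) \<le> gain N (?S (Suc k) + Q (ord k))"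
      by (rule gain_mono[OF psd_N S Q[OF ord_less[OF k]]])
    also have "?S (Suc k) + Q (ord k) = ?S k"
      using psd_carrier[OF Q[OF ord_less[OF k]]] k by (simp add: tail_cov_Suc comm_add_mat[of _ nt nt])
    finally show "secrecy_rate nt K H G ord Q k \<le> gain (M (ord k)) ?C"
      unfolding secrecy_rate_eq[of ord k, OF ord_less[OF k]] using 1 2 by linarith
    show "0 \<le> w (ord k)" by (rule w[OF ord_less[OF k]])
  qed
qed

text \<open>Only the intermediate tail covariance changes: \<open>B + Q a\<close> is replaced by \<open>B + W\<close>, so
  the total power is preserved.\<close>

lemma exchange:
  assumes ord: "ord permutes {..<K}" and k: "Suc k < K" and le: "w (ord k) \<le> w (ord (Suc k))"
    and feas: "feasible_cov nt K P Q"
  obtains Q' where "feasible_cov nt K P Q'"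
    "weighted_rate nt K H G w ord Q \<le>
     weighted_rate nt K H G w (ord \<circ> Transposition.transpose k (Suc k)) Q'"
proof -
  have Q: "psd nt (Q j)" if "j < K" for j
    using feas that by (auto simp: feasible_cov_def)
  have ord_less: "ord j < K" if "j < K" for j
    using permutes_in_image[OF ord, of j] that by simp
  have ord_eq: "ord i = ord j \<longleftrightarrow> i = j" for i j
    by (simp add: inj_eq[OF permutes_inj[OF ord]])
  \<comment> \<open>\<open>a\<close> has the weight at least as large but is encoded second; the
    swap moves it ahead of \<open>b\<close>.\<close>
  define a where "a = ord (Suc k)"
  define b where "b = ord k"
  have ab: "a < K" "b < K" "a \<noteq> b" using ord_less k ord_eq by (auto simp: a_def b_def)
  define ord' where "ord' = ord \<circ> Transposition.transpose k (Suc k)"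
  have ord': "ord' k = a" "ord' (Suc k) = b" "\<And>j. j \<noteq> k \<Longrightarrow> j \<noteq> Suc k \<Longrightarrow> ord' j = ord j"
    by (simp_all add: ord'_def a_def b_def)
  let ?S = "tail_cov nt K ord Q"
  define B where "B = ?S (Suc (Suc k))"
  have B: "psd nt B" unfolding B_def using Q ord_less by (intro psd_tail_cov) auto
  note X = Q[OF ab(1)] and Z = Q[OF ab(2)]
  note c [simp] = X[THEN psd_carrier] Z[THEN psd_carrier] B[THEN psd_carrier]
  obtain Ma where Ma: "psd nt Ma" "\<And>X. psd nt X \<Longrightarrow> gain (M a) (B + X) = gain (M a) B + gain Ma X"
    using gain_shift[OF psd_M[OF ab(1)] B] by metis
  obtain Mb where Mb: "psd nt Mb" "\<And>X. psd nt X \<Longrightarrow> gain (M b) (B + X) = gain (M b) B + gain Mb X"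
    using gain_shift[OF psd_M[OF ab(2)] B] by metis
  obtain N' where N': "psd nt N'" "\<And>X. psd nt X \<Longrightarrow> gain N (B + X) = gain N B + gain N' X"
    using gain_shift[OF psd_N B] by metis
  obtain W where W: "psd nt W" "psd nt (Q a + Q b - W)" and reflect:
    "\<And>N. psd nt N \<Longrightarrow>
      gain Ma (Q a) + gain Ma W + gain N (Q a + Q b) \<le> gain N (Q a) + gain N W + gain Ma (Q a + Q b)"
    using reflection_exists[OF Ma(1) X Z] by metis
  note cW [simp] = W(1)[THEN psd_carrier]
  \<comment> \<open>After the swap \<open>b\<close> comes second, so its covariance is the whole
    increment \<open>W\<close> over \<open>B\<close>. Giving the rest to \<open>a\<close> preserves
    the sum of the two covariances.\<close>
  define Q' where "Q' = Q(a := Q a + Q b - W, b := W)"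
  have Q'_simps: "Q' a = Q a + Q b - W" "Q' b = W" "\<And>j. j \<noteq> a \<Longrightarrow> j \<noteq> b \<Longrightarrow> Q' j = Q j"
    using ab by (simp_all add: Q'_def)
  have Q': "psd nt (Q' j)" if "j < K" for j
    using Q[OF that] W by (cases "j = a"; cases "j = b") (auto simp: Q'_def)
  have feas': "feasible_cov nt K P Q'"
  proof -
    have "mtrace (Q a + Q b - W) = mtrace (Q a) + mtrace (Q b) - mtrace W"
      using carrier_matD[OF c(1)] carrier_matD[OF c(2)] carrier_matD[OF cW]
      by (simp add: mtrace_def sum.distrib sum_subtractf)
    then have "(\<Sum>j\<in>{a,b}. Re (mtrace (Q' j))) = (\<Sum>j\<in>{a,b}. Re (mtrace (Q j)))"
      using ab by (simp add: Q'_simps)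
    moreover have "(\<Sum>j\<in>{..<K} - {a,b}. Re (mtrace (Q' j))) = (\<Sum>j\<in>{..<K} - {a,b}. Re (mtrace (Q j)))"
      by (intro sum.cong) (auto simp: Q'_simps)
    ultimately have "(\<Sum>j<K. Re (mtrace (Q' j))) = (\<Sum>j<K. Re (mtrace (Q j)))"
      using ab by (simp add: sum.subset_diff[of "{a,b}" "{..<K}"])
    then show ?thesis using feas Q' by (simp add: feasible_cov_def)
  qed
  let ?S' = "tail_cov nt K ord' Q'"
  have Q'_ord': "Q' (ord' j) = Q (ord j)" if "j \<noteq> k" "j \<noteq> Suc k" for j
    using that ord_eq by (simp add: ord' Q'_simps a_def b_def)
  have "Q b + (B + Q a) = B + (Q a + Q b)"
    using carrier_matD[OF c(1)] carrier_matD[OF c(2)] carrier_matD[OF c(3)]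
    by (intro eq_matI) auto
  then have S1: "?S (Suc k) = B + Q a" "?S k = B + (Q a + Q b)"
    using k ab by (simp_all add: tail_cov_Suc B_def[symmetric] a_def[symmetric] b_def[symmetric] comm_add_mat[of _ nt nt])
  have S'_ge: "?S' j = ?S j" if "Suc (Suc k) \<le> j" for j
    using that Q'_ord' by (auto simp: tail_cov_def intro!: eq_matI sum.cong)
  have S'1: "?S' (Suc k) = B + W"
    using k by (simp add: tail_cov_Suc ord' Q'_simps S'_ge B_def[symmetric] comm_add_mat[of _ nt nt])
  have "?S' k = Q a + Q b - W + (B + W)"
    using k W(2)[THEN psd_carrier] by (simp add: tail_cov_Suc[of k] ord' Q'_simps S'1)
  also have "\<dots> = B + (Q a + Q b)"
    using carrier_matD[OF c(1)] carrier_matD[OF c(2)] carrier_matD[OF c(3)] carrier_matD[OF cW]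
    by (intro eq_matI) auto
  finally have S'k: "?S' k = B + (Q a + Q b)" .
  have S'_le: "?S' j = ?S j" if "j \<le> k" for j
    using that
  proof (induction rule: inc_induct)
    case base
    then show ?case by (simp add: S'k S1)
  next
    case (step m)
    then have "m < K" "m \<noteq> k" "m \<noteq> Suc k" using k by auto
    then show ?case
      using step Q[OF ord_less, THEN psd_carrier] by (simp add: tail_cov_Suc[of m] Q'_ord')
  qed
  have ord'_less: "ord' j < K" if "j < K" for j
    using that ord_less k ab by (cases "j = k"; cases "j = Suc k") (auto simp: ord')
  let ?r = "\<lambda>j. w (ord j) * secrecy_rate nt K H G ord Q j"
  let ?r' = "\<lambda>j. w (ord' j) * secrecy_rate nt K H G ord' Q' j"
  \<comment> \<open>The rate at position \<open>j\<close> depends on the tails at \<open>j\<close>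
    and \<open>Suc j\<close>, and only the tail at \<open>Suc k\<close> has changed.\<close>
  have same: "?r' j = ?r j" if "j \<in> {..<K} - {k, Suc k}" for j
  proof -
    have j: "j < K" "j \<noteq> k" "j \<noteq> Suc k" using that by auto
    then have "?S' j = ?S j" "?S' (Suc j) = ?S (Suc j)"
      using S'_le S'_ge by (cases "j < k"; force)+
    then show ?thesis
      using j ord_less[OF j(1)] by (simp add: secrecy_rate_eq ord')
  qed
  have "?r k + ?r (Suc k) \<le> ?r' k + ?r' (Suc k)"
  proof -
    define \<Delta> where "\<Delta> N = gain N (Q a + Q b) - gain N (Q a) - gain N W" for N
    have "\<Delta> Mb \<le> \<Delta> Ma" "\<Delta> N' \<le> \<Delta> Ma"
      using reflect[OF Mb(1)] reflect[OF N'(1)] by (simp_all add: \<Delta>_def)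
    \<comment> \<open>The difference of rates appears as \<open>w a * (\<Delta> Ma - \<Delta> N') +
      w b * (\<Delta> N' - \<Delta> Mb)\<close>. Regrouping makes both coefficients and both
      brackets nonnegative.\<close>
    then have "0 \<le> w b * (\<Delta> Ma - \<Delta> Mb) + (w a - w b) * (\<Delta> Ma - \<Delta> N')"
      using le w[OF ab(2)] by (simp add: a_def b_def)
    also have "\<dots> = (?r' k + ?r' (Suc k)) - (?r k + ?r (Suc k))"
      using k ab X Z W psd_add[OF X Z]
      by (simp add: secrecy_rate_eq ord' a_def[symmetric] b_def[symmetric] S1 S'1 S'k S'_ge B_def[symmetric]
          Ma(2) Mb(2) N'(2) \<Delta>_def) (simp add: algebra_simps)
    finally show ?thesis by simp
  qed
  then have "(\<Sum>j\<in>{k, Suc k}. ?r j) \<le> (\<Sum>j\<in>{k, Suc k}. ?r' j)"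
    by simp
  then have "weighted_rate nt K H G w ord Q \<le> weighted_rate nt K H G w ord' Q'"
    using k same unfolding weighted_rate_def
    by (simp add: sum.subset_diff[of "{k, Suc k}" "{..<K}"])
  with feas' show thesis by (intro that) (simp_all add: ord'_def)
qed

lemma phi_exchange:
  assumes ord: "ord permutes {..<K}" and k: "Suc k < K" and le: "w (ord k) \<le> w (ord (Suc k))"
  shows "phi nt K H G w P ord \<le> phi nt K H G w P (ord \<circ> Transposition.transpose k (Suc k))"
proof -
  \<comment> \<open>Zero covariances show that the set of rates is nonempty, as
    \<open>cSup_mono\<close> demands.\<close>
  have "feasible_cov nt K P (\<lambda>_. 0\<^sub>m nt nt)"
    using P by (simp add: feasible_cov_def psd_zero mtrace_def)
  moreover have perm: "ord \<circ> Transposition.transpose k (Suc k) permutes {..<K}"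
    using k by (intro permutes_compose[OF permutes_swap_id ord]) auto
  ultimately show ?thesis
    unfolding phi_eq
  proof (intro cSup_mono bdd_above_weighted_rate)
    fix r assume "r \<in> weighted_rate nt K H G w ord ` {Q. feasible_cov nt K P Q}"
    then obtain Q where "feasible_cov nt K P Q" "r = weighted_rate nt K H G w ord Q" by auto
    then show "\<exists>r'\<in>weighted_rate nt K H G w (ord \<circ> Transposition.transpose k (Suc k)) ` {Q. feasible_cov nt K P Q}. r \<le> r'"
      using exchange[OF assms] by (metis image_eqI mem_Collect_eq)
  qed auto
qed

text \<open>Bubble sort by the position in \<open>pistar\<close>. At a descent of
  \<open>\<sigma>\<close> the two neighbours satisfy the weight condition of
  \<open>phi_exchange\<close>, so swapping them cannot lower \<open>phi\<close>. Sorting by position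
  instead of by weight makes the process end at \<open>pistar\<close> itself even when weights are
  tied.\<close>

lemma phi_le_sorted:
  assumes sorted: "pistar permutes {..<K}" "\<And>i j. i \<le> j \<Longrightarrow> j < K \<Longrightarrow> w (pistar j) \<le> w (pistar i)"
    and ord: "ord permutes {..<K}"
  shows "phi nt K H G w P ord \<le> phi nt K H G w P pistar"
  using ord
proof (induction "\<Sum>j<K. (K - j) * inv_into UNIV pistar (ord j)" arbitrary: ord rule: less_induct)
  case less
  define \<sigma> where "\<sigma> = inv_into UNIV pistar \<circ> ord"
  have \<sigma>: "\<sigma> permutes {..<K}"
    unfolding \<sigma>_def by (rule permutes_compose[OF less.prems permutes_inv[OF sorted(1)]])
  have ord_eq: "ord j = pistar (\<sigma> j)" for j
    unfolding \<sigma>_def o_apply by (rule permutes_inverses(1)[OF sorted(1), symmetric])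
  show ?case
  proof (cases "\<exists>k. Suc k < K \<and> \<sigma> (Suc k) < \<sigma> k")
    case True
    then obtain k where k: "Suc k < K" "\<sigma> (Suc k) < \<sigma> k" by blast
    let ?t = "Transposition.transpose k (Suc k)"
    have perm: "ord \<circ> ?t permutes {..<K}"
      using k by (intro permutes_compose[OF permutes_swap_id less.prems]) auto
    have "w (ord k) \<le> w (ord (Suc k))"
      unfolding ord_eq using k permutes_in_image[OF \<sigma>, of k] by (intro sorted(2)) auto
    note phi_exchange[OF less.prems k(1) this]
    also \<comment> \<open>a swap at a descent of \<open>\<sigma>\<close> lowers \<open>\<Sum>j. (K - j) * \<sigma> j\<close>\<close>
    have "phi nt K H G w P (ord \<circ> ?t) \<le> phi nt K H G w P pistar"
    proof (rule less.hyps[OF _ perm])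
      let ?f = "\<lambda>j. (K - j) * \<sigma> j" and ?g = "\<lambda>j. (K - j) * \<sigma> (?t j)"
      have "K - k = Suc (K - Suc k)" using k by simp
      then have "(\<Sum>j\<in>{k, Suc k}. ?g j) < (\<Sum>j\<in>{k, Suc k}. ?f j)"
        using k(2) by simp
      moreover have "(\<Sum>j\<in>{..<K} - {k, Suc k}. ?g j) = (\<Sum>j\<in>{..<K} - {k, Suc k}. ?f j)"
        by (intro sum.cong) (auto simp: Transposition.transpose_def)
      ultimately have "(\<Sum>j<K. ?g j) < (\<Sum>j<K. ?f j)"
        using k by (simp add: sum.subset_diff[of "{k, Suc k}" "{..<K}"])
      then show "(\<Sum>j<K. (K - j) * inv_into UNIV pistar ((ord \<circ> ?t) j)) < (\<Sum>j<K. (K - j) * inv_into UNIV pistar (ord j))"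
        by (simp add: \<sigma>_def)
    qed
    finally show ?thesis .
  next
    case False
    have mono: "\<sigma> j < \<sigma> (Suc j)" if "Suc j < K" for j
    proof -
      have "\<sigma> j \<noteq> \<sigma> (Suc j)" by (simp add: inj_eq[OF permutes_inj[OF \<sigma>]])
      moreover have "\<not> \<sigma> (Suc j) < \<sigma> j" using False that by blast
      ultimately show ?thesis by simp
    qed
    \<comment> \<open>Without descents \<open>\<sigma>\<close> is strictly increasing on the
      positions, hence dominates the identity; since a permutation preserves the sum of the
      positions, it must be the identity.\<close>
    have ge: "j \<le> \<sigma> j" if "j < K" for j
      using that
    proof (induction j)
      case (Suc j)
      then show ?case using mono[of j] by simp
    qed simp
    have "(\<Sum>j<K. \<sigma> j) = (\<Sum>j<K. j)"
      using sum.permute[OF \<sigma>, of id] by (simp add: o_def)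
    then have "\<sigma> j = j" if "j < K" for j
      using sum_mono_inv[of id "{..<K}" \<sigma> j] ge that by simp
    moreover have "\<sigma> j = j" if "\<not> j < K" for j
      using permutes_not_in[OF \<sigma>] that by simp
    ultimately have "\<sigma> j = j" for j by blast
    then have "ord = pistar"
      unfolding fun_eq_iff ord_eq by (intro allI arg_cong[where f = pistar])
    then show ?thesis by simp
  qed
qed

end

theorem theorem1:
  fixes K nt ne :: nat and n :: "nat \<Rightarrow> nat"
    and H :: "nat \<Rightarrow> complex mat" and G :: "complex mat"
    and w :: "nat \<Rightarrow> real" and P :: real and pistar :: "nat \<Rightarrow> nat"
  assumes "\<And>k. k < K \<Longrightarrow> H k \<in> carrier_mat (n k) nt"
    and "G \<in> carrier_mat ne nt"
    and "P > 0"
    and "\<And>k. k < K \<Longrightarrow> w k \<ge> 0"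
    and "(\<Sum>k<K. w k) = 1"
    and "pistar permutes {..<K}"
    and "\<And>i j. i \<le> j \<Longrightarrow> j < K \<Longrightarrow> w (pistar j) \<le> w (pistar i)"
  shows "phi nt K H G w P pistar = (MAX ord \<in> {ord. ord permutes {..<K}}. phi nt K H G w P ord)"
proof (rule Max_eqI[symmetric])
  interpret wiretap_channel K nt ne n H G w P
    using assms(1-4) by unfold_locales
  show "y \<le> phi nt K H G w P pistar" if "y \<in> phi nt K H G w P ` {ord. ord permutes {..<K}}" for y
    using that phi_le_sorted[OF assms(6,7)] by auto
qed (use assms(6) in \<open>auto simp: finite_permutations\<close>)

end
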